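(* Let $N\ge 1$ and let $f:\{0,1\}^N\to\{0,1\}$ be a Boolean function. Then $\widetilde{deg}(f)\le D(f)\le 216\,\widetilde{deg}(f)^6$.
   Context: $D(f)$ is the deterministic decision tree complexity of $f$: the minimum, over all deterministic classical algorithms (decision trees) that compute $f(X)$ for every $X\in\{0,1\}^N$ by adaptively querying individual bits $x_i$ of $X$, of the worst-case number of queries (the depth of the tree). A real $N$-variate multilinear polynomial $p:\mathbb{R}^N\to\mathbb{R}$ approximates $f$ if $|p(X)-f(X)|\le 1/3$ for all $X\in\{0,1\}^N$. The approximate degree $\widetilde{deg}(f)$ is the minimum degree of a polynomial that approximates $f$. *)

theory Defs
  imports "HOL-Analysis.Analysis"
begin

text \<open>
  The Boolean cube of dimension \<open>N = CARD('n) \<ge> 1\<close> is the type \<open>bool ^ 'n\<close>, with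
  \<open>False\<close> as 0 and \<open>True\<close> as 1.
\<close>

text \<open>
  In \<open>Query i t0 t1\<close> the computation continues with \<open>t0\<close> if the queried bit is 0 and
  with \<open>t1\<close> if it is 1.
\<close>

datatype 'n dtree = Leaf bool | Query 'n "'n dtree" "'n dtree"

fun run :: "'n::finite dtree \<Rightarrow> bool ^ 'n \<Rightarrow> bool" where
  "run (Leaf b) X = b"
| "run (Query i t0 t1) X = (if X $ i then run t1 X else run t0 X)"

fun depth :: "'n dtree \<Rightarrow> nat" where
  "depth (Leaf b) = 0"
| "depth (Query i t0 t1) = Suc (max (depth t0) (depth t1))"

definition computes :: "'n::finite dtree \<Rightarrow> (bool ^ 'n \<Rightarrow> bool) \<Rightarrow> bool" where
  "computes t f \<longleftrightarrow> (\<forall>X. run t X = f X)"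

definition det_complexity :: "(bool ^ 'n::finite \<Rightarrow> bool) \<Rightarrow> nat" where
  "det_complexity f = (LEAST d. \<exists>t. computes t f \<and> depth t = d)"

text \<open>
  A real multilinear polynomial is given by its coefficients: \<open>c S\<close> is the coefficient
  of the monomial in which exactly the variables indexed by \<open>S\<close> occur.  The zero polynomial
  gets degree 0.
\<close>

type_synonym 'n mlpoly = "'n set \<Rightarrow> real"

definition mlpoly_eval :: "'n::finite mlpoly \<Rightarrow> real ^ 'n \<Rightarrow> real" where
  "mlpoly_eval c x = (\<Sum>S\<in>UNIV. c S * (\<Prod>i\<in>S. x $ i))"

definition mlpoly_degree :: "'n::finite mlpoly \<Rightarrow> nat" where
  "mlpoly_degree c = Max (insert 0 (card ` {S. c S \<noteq> 0}))"

definition real_point :: "bool ^ 'n::finite \<Rightarrow> real ^ 'n" where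
  "real_point X = (\<chi> i. of_bool (X $ i))"

definition approximates :: "'n::finite mlpoly \<Rightarrow> (bool ^ 'n \<Rightarrow> bool) \<Rightarrow> bool" where
  "approximates c f \<longleftrightarrow>
     (\<forall>X. \<bar>mlpoly_eval c (real_point X) - of_bool (f X)\<bar> \<le> 1 / 3)"

definition approx_degree :: "(bool ^ 'n::finite \<Rightarrow> bool) \<Rightarrow> nat" where
  "approx_degree f = (LEAST d. \<exists>c. approximates c f \<and> mlpoly_degree c = d)"

end

theory Submission
  imports Defs "HOL-Computational_Algebra.Polynomial"
begin

text \<open>
  For the upper bound, fix an input with \<open>b\<close> disjoint sensitive blocks and flip each block
  independently with probability \<open>t\<close>.  The expected value of an approximating polynomial of
  degree \<open>d\<close> is a univariate polynomial \<open>q\<close> of degree at most \<open>d\<close> with \<open>\<bar>q - 1/2\<bar> \<le> 5/6\<close> on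
  all of \<open>[0, 1]\<close> and \<open>\<bar>q'(0)\<bar> \<ge> b/3\<close>, so Markov's inequality is only needed at an endpoint, and
  it gives \<open>b \<le> 5 d\<^sup>2\<close>.  Unions of maximal families of minimal sensitive blocks are certificates
  of size at most \<open>bs\<^sup>2\<close>, and querying \<open>bs\<close> certificates of consistent 1-inputs determines the
  function, so \<open>D \<le> bs\<^sup>3 \<le> 125 d\<^sup>6\<close>.
\<close>

section \<open>Markov's inequality at an endpoint\<close>

fun chebyshev_poly :: "nat \<Rightarrow> real poly" where
  "chebyshev_poly 0 = 1"
| "chebyshev_poly (Suc 0) = [:0, 1:]"
| "chebyshev_poly (Suc (Suc n)) = [:0, 2:] * chebyshev_poly (Suc n) - chebyshev_poly n"

lemma poly_chebyshev_cos: "poly (chebyshev_poly n) (cos t) = cos (real n * t)"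
proof (induction n rule: chebyshev_poly.induct)
  case (3 n)
  have "cos (real (Suc (Suc n)) * t) = cos (real (Suc n) * t + t)"
    by (simp add: algebra_simps)
  moreover have "cos (real n * t) = cos (real (Suc n) * t - t)"
    by (simp add: algebra_simps)
  ultimately show ?case
    using 3 by (simp only: cos_add cos_diff) (simp add: algebra_simps)
qed auto

lemma degree_chebyshev_poly: "degree (chebyshev_poly n) \<le> n"
proof (induction n rule: chebyshev_poly.induct)
  case (3 n)
  have "degree ([:0, 2:] * chebyshev_poly (Suc n)) \<le> 1 + Suc n"
    using 3 by (intro order.trans[OF degree_mult_le]) (auto intro!: add_mono)
  then show ?case
    using 3 by (auto intro!: degree_diff_le)
qed auto

lemma poly_chebyshev_1: "poly (chebyshev_poly n) 1 = 1"
  using poly_chebyshev_cos[of n 0] by simp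

lemma pderiv_chebyshev_1: "poly (pderiv (chebyshev_poly n)) 1 = real n ^ 2"
proof (induction n rule: chebyshev_poly.induct)
  case (3 n)
  \<comment> \<open>At 1 the differentiated recurrence reads
    \<open>(n + 2)^2 = 2 + 2 * (n + 1)^2 - n^2\<close>.\<close>
  then show ?case
    by (simp add: pderiv_diff pderiv_mult pderiv_smult pderiv_pCons poly_chebyshev_1 power2_eq_square
        algebra_simps del: mult_pCons_left)
qed (auto simp: pderiv_pCons)

text \<open>The intervals from \<open>u (Suc j)\<close> (excluded) to \<open>u j\<close> (included)
  are disjoint, and each contains a root by the intermediate value theorem. Including the upper end
  covers the case that \<open>p\<close> vanishes at \<open>u 0\<close>.\<close>

lemma alternating_imp_degree_ge:
  fixes p :: "real poly"
  assumes dec: "\<And>i j. i < j \<Longrightarrow> j \<le> d \<Longrightarrow> u j < u i"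
    and first: "poly p (u 0) \<le> 0"
    and sgn: "\<And>j. 0 < j \<Longrightarrow> j \<le> d \<Longrightarrow> (-1) ^ j * poly p (u j) < 0"
  shows "d \<le> degree p"
proof (cases "d = 0")
  case False
  have "\<exists>z. u (Suc j) < z \<and> z \<le> u j \<and> poly p z = 0" if "j < d" for j
  proof (cases "poly p (u j) = 0")
    case True
    then show ?thesis
      using dec[of j "Suc j"] that by auto
  next
    case False
    have "(-1) ^ j * poly p (u j) < 0"
      using False first sgn[of j] that by (cases "j = 0") auto
    moreover have "(-1) ^ Suc j * poly p (u (Suc j)) < 0"
      using sgn[of "Suc j"] that by simp
    ultimately have "poly p (u (Suc j)) * poly p (u j) < 0"
      by (cases "even j") (auto simp: mult_less_0_iff)
    then show ?thesis
      using poly_IVT[of "u (Suc j)" "u j" p] dec[of j "Suc j"] that by fastforce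
  qed
  then obtain z where z: "\<And>j. j < d \<Longrightarrow> u (Suc j) < z j \<and> z j \<le> u j \<and> poly p (z j) = 0"
    by metis
  have "z j < z i" if "i < j" "j < d" for i j
  proof -
    have "z j \<le> u j" using z that by simp
    also have "\<dots> \<le> u (Suc i)"
      using dec[of "Suc i" j] that by (cases "Suc i = j") auto
    also have "\<dots> < z i" using z that by simp
    finally show ?thesis .
  qed
  then have "inj_on z {..<d}"
    by (metis inj_onI lessThan_iff less_irrefl nat_neq_iff)
  then have "d = card (z ` {..<d})"
    by (simp add: card_image)
  also have "\<dots> \<le> card {x. poly p x = 0}"
  proof (rule card_mono)
    have "p \<noteq> 0" using sgn[of 1] False by auto
    then show "finite {x. poly p x = 0}" by (rule poly_roots_finite)
  qed (use z in auto)
  also have "\<dots> \<le> degree p"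
    using sgn[of 1] False by (intro card_poly_roots_bound) auto
  finally show ?thesis .
qed simp

text \<open>
  If \<open>p'(1)\<close> exceeded the bound, \<open>r = K T\<^sub>d - p\<close> with \<open>K > M\<close> would alternate in sign at the
  \<open>d + 1\<close> extrema of \<open>T\<^sub>d\<close> while \<open>r'(1) \<le> 0\<close>, giving \<open>r'\<close> one root too many.
\<close>

lemma markov_endpoint:
  fixes p :: "real poly"
  assumes deg: "degree p \<le> d"
    and bound: "\<And>x. -1 \<le> x \<Longrightarrow> x \<le> 1 \<Longrightarrow> \<bar>poly p x\<bar> \<le> M"
  shows "poly (pderiv p) 1 \<le> M * real d ^ 2"
proof (cases "d = 0")
  case True
  then show ?thesis using deg by (auto elim: degree_eq_zeroE simp: pderiv_pCons)
next
  case False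
  \<comment> \<open>Strictness of \<open>M < K\<close> keeps \<open>r\<close> nonzero at the
    extrema. At the end \<open>K\<close> becomes the quotient of \<open>poly (pderiv p) 1\<close> by
    \<open>d^2\<close>.\<close>
  have less: "poly (pderiv p) 1 < K * real d ^ 2" if "M < K" for K
  proof (rule ccontr)
    assume neg: "\<not> poly (pderiv p) 1 < K * real d ^ 2"
    define r where "r = smult K (chebyshev_poly d) - p"
    define y where "y j = cos (real j * pi / real d)" for j
    have y_dec: "y j < y i" if "i < j" "j \<le> d" for i j
      unfolding y_def using that False
      by (intro cos_monotone_0_pi) (auto simp: divide_simps)
    have sgn_r: "0 < (-1) ^ j * poly r (y j)" for j
    proof -
      have "poly (chebyshev_poly d) (y j) = (-1) ^ j"
        using False by (simp add: y_def poly_chebyshev_cos cos_npi)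
      moreover have "\<bar>poly p (y j)\<bar> < K"
        using bound[of "y j"] \<open>M < K\<close> by (force simp: y_def)
      ultimately show ?thesis
        by (cases "even j") (auto simp: r_def)
    qed
    have "\<exists>x. y (Suc j) < x \<and> x < y j \<and> 0 < (-1) ^ j * poly (pderiv r) x" if "j < d" for j
    proof -
      have lt: "y (Suc j) < y j" using y_dec that by simp
      then obtain x where x: "y (Suc j) < x" "x < y j"
        "poly r (y j) - poly r (y (Suc j)) = (y j - y (Suc j)) * poly (pderiv r) x"
        using poly_MVT[of "y (Suc j)" "y j" r] by blast
      have "0 < (-1) ^ j * (poly r (y j) - poly r (y (Suc j)))"
        using sgn_r[of j] sgn_r[of "Suc j"] by (simp add: algebra_simps)
      then have "0 < (y j - y (Suc j)) * ((-1) ^ j * poly (pderiv r) x)"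
        by (simp add: x(3) mult.left_commute)
      then show ?thesis
        using lt x by (auto simp: zero_less_mult_iff)
    qed
    then obtain \<xi> where \<xi>: "\<And>j. j < d \<Longrightarrow> y (Suc j) < \<xi> j \<and> \<xi> j < y j
        \<and> 0 < (-1) ^ j * poly (pderiv r) (\<xi> j)"
      by metis
    \<comment> \<open>Prepending 1 shifts the index by one, so the positive sign at
      \<open>\<xi> j\<close> becomes the negative one required at \<open>u (Suc j)\<close>. The
      \<open>d + 1\<close> points force degree at least \<open>d\<close> on the derivative of a
      polynomial of degree at most \<open>d\<close>.\<close>
    define u where "u j = (case j of 0 \<Rightarrow> 1 | Suc i \<Rightarrow> \<xi> i)" for j
    have "d \<le> degree (pderiv r)"
    proof (rule alternating_imp_degree_ge[of d u])
      fix i j :: nat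
      assume ij: "i < j" "j \<le> d"
      then obtain j' where j': "j = Suc j'" by (cases j) auto
      have "u j < y j'" using \<xi>[of j'] ij j' by (simp add: u_def)
      also have "\<dots> \<le> y i"
        using y_dec[of i j'] ij j' by (cases "i = j'") auto
      also have "\<dots> \<le> u i"
        using \<xi>[of "i - 1"] ij by (cases i) (auto simp: u_def y_def)
      finally show "u j < u i" .
    next
      show "poly (pderiv r) (u 0) \<le> 0"
        using neg by (simp add: u_def r_def pderiv_diff pderiv_smult pderiv_chebyshev_1)
    next
      fix j assume "0 < j" "j \<le> d"
      then show "(-1) ^ j * poly (pderiv r) (u j) < 0"
        using \<xi>[of "j - 1"] by (cases j) (auto simp: u_def)
    qed
    moreover have "degree r \<le> d"
      unfolding r_def using deg degree_chebyshev_poly[of d]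
      by (intro degree_diff_le order.trans[OF degree_smult_le]) auto
    ultimately show False
      using False by (simp add: degree_pderiv)
  qed
  show ?thesis
  proof (rule ccontr)
    assume "\<not> ?thesis"
    then have "M < poly (pderiv p) 1 / real d ^ 2"
      using False by (simp add: pos_less_divide_eq)
    from less[OF this] show False
      using False by simp
  qed
qed

text \<open>The substitution t = (1 - x)/2 carries x = 1 to t = 0 and multiplies the derivative by
  -1/2, hence the factor 2. The endpoint bound is one-sided, so it is applied to \<open>p\<close>
  and to \<open>- p\<close>.\<close>

lemma markov_unit_interval_0:
  fixes q :: "real poly"
  assumes deg: "degree q \<le> d"
    and bound: "\<And>t. 0 \<le> t \<Longrightarrow> t \<le> 1 \<Longrightarrow> \<bar>poly q t - m\<bar> \<le> M"
  shows "\<bar>poly (pderiv q) 0\<bar> \<le> 2 * M * real d ^ 2"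
proof -
  define p where "p = pcompose (q - [:m:]) [:1/2, -1/2:]"
  have p: "poly p x = poly q ((1 - x) / 2) - m" for x
    by (simp add: p_def poly_pcompose diff_divide_distrib)
  have deg_p: "degree p \<le> d"
    using deg by (auto simp: p_def degree_pcompose intro: degree_diff_le)
  have bound_p: "\<bar>poly p x\<bar> \<le> M" if "-1 \<le> x" "x \<le> 1" for x
    unfolding p using that by (intro bound) auto
  have "poly (pderiv p) 1 = - poly (pderiv q) 0 / 2"
    by (simp add: p_def pderiv_pcompose pderiv_diff pderiv_pCons poly_pcompose)
  moreover have "poly (pderiv p) 1 \<le> M * real d ^ 2"
    by (rule markov_endpoint[OF deg_p bound_p])
  moreover have "poly (pderiv (- p)) 1 \<le> M * real d ^ 2"
    by (rule markov_endpoint) (use deg_p bound_p in auto)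
  ultimately show ?thesis
    by (simp add: pderiv_minus abs_le_iff)
qed

section \<open>Block sensitivity and approximate degree\<close>

definition flip :: "bool ^ 'n::finite \<Rightarrow> 'n set \<Rightarrow> bool ^ 'n" where
  "flip X B = (\<chi> i. if i \<in> B then \<not> X $ i else X $ i)"

lemma flip_nth [simp]: "flip X B $ i = (if i \<in> B then \<not> X $ i else X $ i)"
  by (simp add: flip_def)

lemma flip_empty [simp]: "flip X {} = X"
  by (simp add: vec_eq_iff)

text \<open>The largest size of such a family is the block sensitivity of \<open>f\<close> at
  \<open>X\<close>. Since \<open>flip X {} = X\<close>, the blocks are nonempty.\<close>

definition sensitive_blocks :: "(bool ^ 'n::finite \<Rightarrow> bool) \<Rightarrow> bool ^ 'n \<Rightarrow> 'n set set \<Rightarrow> bool" where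
  "sensitive_blocks f X F \<longleftrightarrow> pairwise disjnt F \<and> (\<forall>B\<in>F. f (flip X B) \<noteq> f X)"

lemma card_le_mlpoly_degree:
  fixes c :: "'n::finite mlpoly"
  assumes "c S \<noteq> 0"
  shows "card S \<le> mlpoly_degree c"
  unfolding mlpoly_degree_def using assms by (intro Max_ge) auto

text \<open>
  The polynomial \<open>q\<close> is the expectation of \<open>c\<close> when each block is flipped independently with
  probability \<open>t\<close>.  Every block contributes to a monomial a factor that is affine in \<open>t\<close>, and
  only blocks meeting the monomial contribute a nonconstant one.
\<close>

lemma block_symmetrization:
  fixes c :: "'n::finite mlpoly"
  assumes disj: "pairwise disjnt F"
  obtains q :: "real poly" where "degree q \<le> mlpoly_degree c"
    and "\<And>t. poly q t = (\<Sum>Z\<in>Pow F. t ^ card Z * (1 - t) ^ card (F - Z)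
           * mlpoly_eval c (real_point (flip X (\<Union>Z))))"
proof -
  define x :: "'n \<Rightarrow> real" where "x i = of_bool (X $ i)" for i
  \<comment> \<open>\<open>a S B\<close> and \<open>b S B\<close> are what block \<open>B\<close>
    contributes to monomial \<open>S\<close> when left alone and when flipped. Averaging them with
    weights 1 - t and t gives the linear factor in \<open>m\<close>.\<close>
  define a where "a S B = (\<Prod>i\<in>S \<inter> B. x i)" for S B
  define b where "b S B = (\<Prod>i\<in>S \<inter> B. 1 - x i)" for S B
  define e where "e S = c S * (\<Prod>i\<in>S - \<Union>F. x i)" for S
  define m where "m S = (\<Prod>B\<in>{B\<in>F. S \<inter> B \<noteq> {}}. [:a S B, b S B - a S B:])" for S
  define q where "q = (\<Sum>S\<in>UNIV. smult (e S) (m S))"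
  have "degree (smult (e S) (m S)) \<le> mlpoly_degree c" for S
  proof (cases "c S = 0")
    case False
    let ?F = "{B\<in>F. S \<inter> B \<noteq> {}}"
    have "degree (m S) \<le> (\<Sum>B\<in>?F. degree [:a S B, b S B - a S B:])"
      unfolding m_def by (rule order.trans[OF degree_prod_sum_le]) (auto simp: comp_def)
    also have "\<dots> \<le> (\<Sum>B\<in>?F. 1)"
      by (intro sum_mono) auto
    also have "\<dots> \<le> (\<Sum>B\<in>?F. card (S \<inter> B))"
      by (intro sum_mono) (auto simp: Suc_le_eq card_gt_0_iff)
    also have "\<dots> = card (\<Union>B\<in>?F. S \<inter> B)"
      using disj by (intro card_UN_disjoint[symmetric]) (auto simp: pairwise_def disjnt_def)
    also have "\<dots> \<le> card S"
      by (intro card_mono) auto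
    also have "\<dots> \<le> mlpoly_degree c"
      using False by (rule card_le_mlpoly_degree)
    finally show ?thesis
      by (intro order.trans[OF degree_smult_le])
  qed (simp add: e_def)
  then have "degree q \<le> mlpoly_degree c"
    unfolding q_def by (intro degree_sum_le) auto
  moreover have "poly q t = (\<Sum>Z\<in>Pow F. t ^ card Z * (1 - t) ^ card (F - Z)
           * mlpoly_eval c (real_point (flip X (\<Union>Z))))" for t
  proof -
    have monom: "(\<Prod>i\<in>S. real_point (flip X (\<Union>Z)) $ i)
        = (\<Prod>i\<in>S - \<Union>F. x i) * ((\<Prod>B\<in>Z. b S B) * (\<Prod>B\<in>F - Z. a S B))"
      if "Z \<subseteq> F" for S Z
    proof -
      let ?y = "\<lambda>i. real_point (flip X (\<Union>Z)) $ i"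
      have y: "?y i = (if i \<in> \<Union>Z then 1 - x i else x i)" for i
        by (simp add: real_point_def x_def)
      have "S = (S - \<Union>F) \<union> (\<Union>B\<in>F. S \<inter> B)" by auto
      then have "prod ?y S = prod ?y ((S - \<Union>F) \<union> (\<Union>B\<in>F. S \<inter> B))" by simp
      also have "\<dots> = prod ?y (S - \<Union>F) * prod ?y (\<Union>B\<in>F. S \<inter> B)"
        by (intro prod.union_disjoint) auto
      also have "prod ?y (\<Union>B\<in>F. S \<inter> B) = (\<Prod>B\<in>F. prod ?y (S \<inter> B))"
        using disj by (intro prod.UNION_disjoint) (auto simp: pairwise_def disjnt_def)
      also have "\<dots> = (\<Prod>B\<in>Z. prod ?y (S \<inter> B)) * (\<Prod>B\<in>F - Z. prod ?y (S \<inter> B))"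
        using prod.subset_diff[of Z F] that by (simp add: mult.commute)
      also have "(\<Prod>B\<in>Z. prod ?y (S \<inter> B)) = (\<Prod>B\<in>Z. b S B)"
        unfolding b_def y by (intro prod.cong) auto
      also have "(\<Prod>B\<in>F - Z. prod ?y (S \<inter> B)) = (\<Prod>B\<in>F - Z. a S B)"
        unfolding a_def
      proof (intro prod.cong refl)
        fix B i assume B: "B \<in> F - Z" "i \<in> S \<inter> B"
        have "disjnt B A" if "A \<in> Z" for A
          using disj B \<open>Z \<subseteq> F\<close> that by (intro pairwiseD[of disjnt F]) auto
        then have "i \<notin> \<Union>Z"
          using B by (auto simp: disjnt_iff)
        then show "?y i = x i" by (simp add: y)
      qed
      also have "prod ?y (S - \<Union>F) = (\<Prod>i\<in>S - \<Union>F. x i)"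
        using that by (intro prod.cong) (auto simp: y)
      finally show ?thesis .
    qed
    have poly_m: "poly (m S) t = (\<Sum>Z\<in>Pow F. t ^ card Z * (1 - t) ^ card (F - Z)
        * ((\<Prod>B\<in>Z. b S B) * (\<Prod>B\<in>F - Z. a S B)))" for S
    proof -
      have "poly (m S) t = (\<Prod>B\<in>{B\<in>F. S \<inter> B \<noteq> {}}. t * b S B + (1 - t) * a S B)"
        unfolding m_def poly_prod by (intro prod.cong) (auto simp: algebra_simps)
      \<comment> \<open>A block missing \<open>S\<close> has the factor t + (1 - t) = 1. The full
        product then expands over the sets \<open>Z\<close> of flipped blocks.\<close>
      also have "\<dots> = (\<Prod>B\<in>F. t * b S B + (1 - t) * a S B)"
        by (intro prod.mono_neutral_left) (auto simp: a_def b_def)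
      finally show ?thesis
        by (simp add: prod_add prod.distrib mult_ac)
    qed
    have "poly q t = (\<Sum>S\<in>UNIV. \<Sum>Z\<in>Pow F. t ^ card Z * (1 - t) ^ card (F - Z)
        * (e S * ((\<Prod>B\<in>Z. b S B) * (\<Prod>B\<in>F - Z. a S B))))"
      unfolding q_def by (simp add: poly_sum poly_m sum_distrib_left mult_ac)
    also have "\<dots> = (\<Sum>Z\<in>Pow F. \<Sum>S\<in>UNIV. t ^ card Z * (1 - t) ^ card (F - Z)
        * (c S * (\<Prod>i\<in>S. real_point (flip X (\<Union>Z)) $ i)))"
      by (subst sum.swap, intro sum.cong refl) (auto simp: monom e_def mult_ac)
    finally show ?thesis
      by (simp add: mlpoly_eval_def sum_distrib_left)
  qed
  ultimately show ?thesis by (rule that)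
qed

text \<open>Each sensitive block adds at least 1/3 to the derivative of \<open>q\<close> at 0,
  always with the same sign, while Markov bounds that derivative by 2 * (5/6) times the squared
  degree.\<close>

lemma card_sensitive_blocks_le:
  fixes c :: "'n::finite mlpoly"
  assumes approx: "approximates c f" and sens: "sensitive_blocks f X F"
  shows "card F \<le> 5 * mlpoly_degree c ^ 2"
proof -
  define P where "P Y = mlpoly_eval c (real_point Y)" for Y
  have P: "\<bar>P Y - of_bool (f Y)\<bar> \<le> 1 / 3" for Y
    using approx by (simp add: approximates_def P_def)
  have disj: "pairwise disjnt F"
    using sens by (simp add: sensitive_blocks_def)
  obtain q :: "real poly" where deg: "degree q \<le> mlpoly_degree c"
    and q: "\<And>t. poly q t = (\<Sum>Z\<in>Pow F. t ^ card Z * (1 - t) ^ card (F - Z) * P (flip X (\<Union>Z)))"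
    using block_symmetrization[OF disj, of c X] unfolding P_def by blast
  have weights: "(\<Sum>Z\<in>Pow F. t ^ card Z * (1 - t) ^ card (F - Z)) = 1" for t :: real
    using prod_add[of F "\<lambda>_. t" "\<lambda>_. 1 - t"] by simp
  \<comment> \<open>On the cube \<open>P\<close> takes values in [-1/3, 4/3], with centre 1/2 and
    half-length 5/6, and \<open>poly q t\<close> is a weighted average of such values.\<close>
  have "\<bar>poly q t - 1 / 2\<bar> \<le> 5 / 6" if "0 \<le> t" "t \<le> 1" for t
  proof -
    let ?w = "\<lambda>Z. t ^ card Z * (1 - t) ^ card (F - Z)"
    have "poly q t - 1 / 2 = poly q t - (\<Sum>Z\<in>Pow F. ?w Z) * (1 / 2)"
      by (simp only: weights)
    also have "\<dots> = (\<Sum>Z\<in>Pow F. ?w Z * (P (flip X (\<Union>Z)) - 1 / 2))"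
      by (simp add: q sum_distrib_right sum_subtractf right_diff_distrib)
    finally have "\<bar>poly q t - 1 / 2\<bar> \<le> (\<Sum>Z\<in>Pow F. \<bar>?w Z * (P (flip X (\<Union>Z)) - 1 / 2)\<bar>)"
      by (simp only: sum_abs)
    also have "\<dots> \<le> (\<Sum>Z\<in>Pow F. ?w Z * (5 / 6))"
    proof (intro sum_mono)
      fix Z
      have "\<bar>P (flip X (\<Union>Z)) - 1 / 2\<bar> \<le> 5 / 6"
        using P[of "flip X (\<Union>Z)"] unfolding abs_le_iff
        by (cases "f (flip X (\<Union>Z))") auto
      moreover have "0 \<le> ?w Z" using that by simp
      ultimately show "\<bar>?w Z * (P (flip X (\<Union>Z)) - 1 / 2)\<bar> \<le> ?w Z * (5 / 6)"
        by (metis abs_mult abs_of_nonneg mult_left_mono)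
    qed
    also have "\<dots> = 5 / 6"
      by (simp only: weights flip: sum_distrib_right)
    finally show ?thesis .
  qed
  then have markov: "\<bar>poly (pderiv q) 0\<bar> \<le> 2 * (5 / 6) * real (mlpoly_degree c) ^ 2"
    by (rule markov_unit_interval_0[OF deg])
  have q_eq: "q = (\<Sum>Z\<in>Pow F. smult (P (flip X (\<Union>Z))) ([:0, 1:] ^ card Z * [:1, -1:] ^ card (F - Z)))"
    by (subst poly_eq_poly_eq_iff[symmetric])
       (auto simp: q fun_eq_iff poly_sum poly_power mult_ac intro!: sum.cong)
  \<comment> \<open>To first order at t = 0 at most one block is flipped, so only \<open>{}\<close>
    and the singletons survive in the derivative.\<close>
  have bern: "poly (pderiv ([:0, 1:] ^ k * [:1, -1:] ^ l)) 0
      = (if k = 0 then - real l else if k = 1 then 1 else 0)" for k l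
  proof -
    have "poly (pderiv [:0, 1 :: real:]) 0 = 1" "poly (pderiv [:1, -1 :: real:]) 0 = -1"
      by (auto simp: pderiv_pCons)
    then show ?thesis
      by (cases k; cases l) (auto simp: pderiv_mult pderiv_power poly_power simp del: mult_pCons_left)
  qed
  have "poly (pderiv q) 0 = (\<Sum>Z\<in>Pow F. P (flip X (\<Union>Z)) *
      (if card Z = 0 then - real (card (F - Z)) else if card Z = 1 then 1 else 0))"
    by (subst q_eq) (simp add: higher_pderiv_sum[of 1, simplified] poly_sum pderiv_smult bern)
  also have "\<dots> = (\<Sum>Z\<in>insert {} ((\<lambda>B. {B}) ` F). P (flip X (\<Union>Z)) *
      (if card Z = 0 then - real (card (F - Z)) else if card Z = 1 then 1 else 0))"
    by (intro sum.mono_neutral_right) (auto simp: card_1_singleton_iff)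
  also have "\<dots> = (\<Sum>B\<in>F. P (flip X B) - P X)"
    by (subst sum.insert) (auto simp: sum.reindex sum_subtractf mult.commute)
  finally have deriv: "poly (pderiv q) 0 = (\<Sum>B\<in>F. P (flip X B) - P X)" .
  define s :: real where "s = (if f X then -1 else 1)"
  have "real (card F) * (1 / 3) = (\<Sum>B\<in>F. 1 / 3)" by simp
  also have "\<dots> \<le> (\<Sum>B\<in>F. s * (P (flip X B) - P X))"
  proof (intro sum_mono)
    fix B assume "B \<in> F"
    then have "f (flip X B) \<noteq> f X"
      using sens by (simp add: sensitive_blocks_def)
    then show "1 / 3 \<le> s * (P (flip X B) - P X)"
      using P[of "flip X B"] P[of X] unfolding abs_le_iff
      by (cases "f X") (auto simp: s_def)
  qed
  also have "\<dots> = s * poly (pderiv q) 0"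
    by (simp add: deriv sum_distrib_left)
  also have "\<dots> \<le> \<bar>poly (pderiv q) 0\<bar>"
    by (auto simp: s_def)
  finally have "real (card F) \<le> 5 * real (mlpoly_degree c) ^ 2"
    using markov by simp
  then have "real (card F) \<le> real (5 * mlpoly_degree c ^ 2)" by simp
  then show ?thesis by (simp only: of_nat_le_iff)
qed

section \<open>Decision trees from block sensitivity\<close>

text \<open>Take a largest family of disjoint sensitive blocks of size at most \<open>k\<close>. If
  its union were no certificate, a minimal sensitive block inside the disagreement set would avoid
  the union, have size at most \<open>k\<close>, and enlarge the family.\<close>

lemma certificate_exists:
  fixes f :: "bool ^ 'n::finite \<Rightarrow> bool"
  assumes bs: "\<And>X F. sensitive_blocks f X F \<Longrightarrow> card F \<le> k"
  obtains C where "card C \<le> k ^ 2" and "\<And>Y. (\<And>i. i \<in> C \<Longrightarrow> Y $ i = X $ i) \<Longrightarrow> f Y = f X"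
proof -
  define Q where "Q F \<longleftrightarrow> sensitive_blocks f X F \<and> (\<forall>B\<in>F. card B \<le> k)" for F
  have "Q {}" by (simp add: Q_def sensitive_blocks_def)
  moreover have "\<forall>F. Q F \<longrightarrow> card F < Suc k"
    using bs by (auto simp: Q_def less_Suc_eq_le)
  ultimately obtain F where F: "Q F" and max: "\<And>G. Q G \<Longrightarrow> card G \<le> card F"
    using ex_has_greatest_nat[of Q "{}" card "Suc k"] by blast
  show ?thesis
  proof
    have "card (\<Union>F) \<le> (\<Sum>B\<in>F. card B)"
      by (rule card_Union_le_sum_card)
    also have "\<dots> \<le> card F * k"
      using sum_bounded_above[of F card k] F by (simp add: Q_def)
    also have "\<dots> \<le> k ^ 2"
      using bs[of X F] F by (simp add: Q_def power2_eq_square)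
    finally show "card (\<Union>F) \<le> k ^ 2" .
  next
    fix Y assume Y: "\<And>i. i \<in> \<Union>F \<Longrightarrow> Y $ i = X $ i"
    show "f Y = f X"
    proof (rule ccontr)
      assume neq: "f Y \<noteq> f X"
      define D where "D = {i. Y $ i \<noteq> X $ i}"
      have "flip X D = Y" by (auto simp: vec_eq_iff D_def)
      then have D: "D \<subseteq> D \<and> f (flip X D) \<noteq> f X" using neq by simp
      obtain B where B: "B \<subseteq> D" "f (flip X B) \<noteq> f X"
        and min: "\<And>A. A \<subseteq> D \<Longrightarrow> f (flip X A) \<noteq> f X \<Longrightarrow> card B \<le> card A"
        using ex_has_least_nat[of "\<lambda>B. B \<subseteq> D \<and> f (flip X B) \<noteq> f X" D card, OF D] by blast
      \<comment> \<open>By minimality, undoing the flip of one variable of \<open>B\<close> restores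
        \<open>f X\<close>. Hence the singletons of \<open>B\<close> are sensitive at
        \<open>flip X B\<close>, and \<open>bs\<close> at that input bounds
        \<open>card B\<close>.\<close>
      have "sensitive_blocks f (flip X B) ((\<lambda>i. {i}) ` B)"
        unfolding sensitive_blocks_def
      proof (intro conjI ballI)
        fix A assume "A \<in> (\<lambda>i. {i}) ` B"
        then obtain i where i: "i \<in> B" "A = {i}" by auto
        have "flip (flip X B) A = flip X (B - {i})"
          using i by (auto simp: vec_eq_iff)
        moreover have "card (B - {i}) < card B"
          using i by (intro psubset_card_mono) auto
        then have "f (flip X (B - {i})) = f X"
          using min[of "B - {i}"] B by fastforce
        ultimately show "f (flip (flip X B) A) \<noteq> f (flip X B)"
          using B by simp
      qed (auto simp: pairwise_def)
      then have "card B \<le> k"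
        using bs by (fastforce simp: card_image)
      moreover have "B \<noteq> {}" using B by auto
      moreover have B_disj: "B \<inter> \<Union>F = {}"
        using B Y by (auto simp: D_def)
      ultimately have "Q (insert B F)"
        using F B by (auto simp: Q_def sensitive_blocks_def pairwise_insert disjnt_def)
      moreover have "B \<notin> F"
        using B_disj \<open>B \<noteq> {}\<close> by auto
      ultimately show False
        using max[of "insert B F"] by simp
    qed
  qed
qed

text \<open>\<open>X0\<close> records the answers on the variables \<open>Q\<close> queried so far.
  The variables of \<open>C\<close> outside \<open>Q\<close> are queried one by one, and each
  outcome continues with its own tree of depth at most \<open>e\<close>.\<close>

lemma query_all:
  fixes f :: "bool ^ 'n::finite \<Rightarrow> bool"
  assumes "finite C"
    and "\<And>X. (\<And>i. i \<in> Q \<Longrightarrow> X $ i = X0 $ i) \<Longrightarrow>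
           \<exists>t. depth t \<le> e \<and> (\<forall>Y. (\<forall>i\<in>Q \<union> C. Y $ i = X $ i) \<longrightarrow> run t Y = f Y)"
  shows "\<exists>t. depth t \<le> card C + e \<and> (\<forall>Y. (\<forall>i\<in>Q. Y $ i = X0 $ i) \<longrightarrow> run t Y = f Y)"
  using assms
proof (induction C arbitrary: Q X0 rule: finite_induct)
  case empty
  then show ?case by simp
next
  case (insert j C)
  show ?case
  proof (cases "j \<in> Q")
    case True
    then have "Q \<union> insert j C = Q \<union> C" by auto
    then obtain t where "depth t \<le> card C + e"
      "\<forall>Y. (\<forall>i\<in>Q. Y $ i = X0 $ i) \<longrightarrow> run t Y = f Y"
      using insert.IH[of Q X0] insert.prems by auto
    then show ?thesis
      using insert.hyps by (intro exI[of _ t]) auto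
  next
    case False
    have "\<exists>t. depth t \<le> card C + e \<and>
        (\<forall>Y. (\<forall>i\<in>Q. Y $ i = X0 $ i) \<and> Y $ j = b \<longrightarrow> run t Y = f Y)" for b
    proof -
      define X1 where "X1 = (\<chi> i. if i = j then b else X0 $ i)"
      have X1: "(\<forall>i\<in>insert j Q. Y $ i = X1 $ i) \<longleftrightarrow> (\<forall>i\<in>Q. Y $ i = X0 $ i) \<and> Y $ j = b" for Y
        using False by (auto simp: X1_def)
      have "\<exists>t. depth t \<le> card C + e \<and>
          (\<forall>Y. (\<forall>i\<in>insert j Q. Y $ i = X1 $ i) \<longrightarrow> run t Y = f Y)"
      proof (rule insert.IH)
        fix X assume "\<And>i. i \<in> insert j Q \<Longrightarrow> X $ i = X1 $ i"
        then have "\<And>i. i \<in> Q \<Longrightarrow> X $ i = X0 $ i" using X1[of X] by blast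
        then show "\<exists>t. depth t \<le> e \<and> (\<forall>Y. (\<forall>i\<in>insert j Q \<union> C. Y $ i = X $ i) \<longrightarrow> run t Y = f Y)"
          using insert.prems[of X] by simp
      qed
      then show ?thesis by (simp only: X1)
    qed
    then obtain t where t: "\<And>b. depth (t b) \<le> card C + e"
      "\<And>b Y. \<forall>i\<in>Q. Y $ i = X0 $ i \<Longrightarrow> Y $ j = b \<Longrightarrow> run (t b) Y = f Y"
      by metis
    show ?thesis
      using t insert.hyps by (intro exI[of _ "Query j (t False) (t True)"]) auto
  qed
qed

text \<open>
  Each round queries a certificate of a consistent 1-input.  Its disagreement with a consistent
  0-input \<open>Y\<close> is a sensitive block of \<open>Y\<close> inside the newly queried variables, so every round
  lowers the bound on the blocks of \<open>Y\<close> among the unqueried ones.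
\<close>

lemma certificate_tree:
  fixes f :: "bool ^ 'n::finite \<Rightarrow> bool"
  assumes cert: "\<And>X. \<exists>C. card C \<le> K \<and> (\<forall>Y. (\<forall>i\<in>C. Y $ i = X $ i) \<longrightarrow> f Y = f X)"
    and bs: "\<And>Y F. (\<And>i. i \<in> Q \<Longrightarrow> Y $ i = X0 $ i) \<Longrightarrow> \<not> f Y \<Longrightarrow> sensitive_blocks f Y F \<Longrightarrow>
           \<Union>F \<subseteq> - Q \<Longrightarrow> card F \<le> m"
  shows "\<exists>t. depth t \<le> m * K \<and> (\<forall>Y. (\<forall>i\<in>Q. Y $ i = X0 $ i) \<longrightarrow> run t Y = f Y)"
  using bs
proof (induction m arbitrary: Q X0)
  case bs: 0
  \<comment> \<open>Otherwise the disagreement set would be one sensitive block of a 0-input outside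
    \<open>Q\<close>. So \<open>f\<close> is constant on the consistent inputs, \<open>X0\<close>
    among them.\<close>
  have "f Y = f Z" if Y: "\<forall>i\<in>Q. Y $ i = X0 $ i" "\<forall>i\<in>Q. Z $ i = X0 $ i" "\<not> f Y" for Y Z
  proof (rule ccontr)
    assume "f Y \<noteq> f Z"
    moreover have "flip Y {i. Y $ i \<noteq> Z $ i} = Z" by (auto simp: vec_eq_iff)
    ultimately have "sensitive_blocks f Y {{i. Y $ i \<noteq> Z $ i}}"
      by (simp add: sensitive_blocks_def)
    then show False
      using bs[of Y "{{i. Y $ i \<noteq> Z $ i}}"] that by auto
  qed
  then show ?case
    by (intro exI[of _ "Leaf (f X0)"]) auto
next
  case (Suc m)
  show ?case
  proof (cases "\<exists>Z. (\<forall>i\<in>Q. Z $ i = X0 $ i) \<and> f Z")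
    case False
    then show ?thesis by (intro exI[of _ "Leaf False"]) auto
  next
    case True
    then obtain Z where Z: "\<And>i. i \<in> Q \<Longrightarrow> Z $ i = X0 $ i" "f Z" by blast
    obtain C where C: "card C \<le> K" "\<And>Y. (\<forall>i\<in>C. Y $ i = Z $ i) \<Longrightarrow> f Y = f Z"
      using cert[of Z] by blast
    have "\<exists>t. depth t \<le> card C + m * K \<and> (\<forall>Y. (\<forall>i\<in>Q. Y $ i = X0 $ i) \<longrightarrow> run t Y = f Y)"
    proof (rule query_all)
      fix X assume X: "\<And>i. i \<in> Q \<Longrightarrow> X $ i = X0 $ i"
      show "\<exists>t. depth t \<le> m * K \<and> (\<forall>Y. (\<forall>i\<in>Q \<union> C. Y $ i = X $ i) \<longrightarrow> run t Y = f Y)"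
      proof (rule Suc.IH)
        fix Y F
        assume Y: "\<And>i. i \<in> Q \<union> C \<Longrightarrow> Y $ i = X $ i" "\<not> f Y"
          and F: "sensitive_blocks f Y F" "\<Union>F \<subseteq> - (Q \<union> C)"
        \<comment> \<open>Flipping \<open>B\<close> makes \<open>Y\<close> agree with
          \<open>Z\<close> on the certificate, which forces the value 1. \<open>B\<close> avoids
          \<open>Q\<close>, where both inputs agree with \<open>X0\<close>, and the blocks of
          \<open>F\<close>, which lie outside \<open>C\<close>.\<close>
        define B where "B = {i \<in> C. Y $ i \<noteq> Z $ i}"
        have YQ: "\<And>i. i \<in> Q \<Longrightarrow> Y $ i = X0 $ i" using X Y by auto
        have fB: "f (flip Y B)"
          using C(2)[of "flip Y B"] Z(2) by (auto simp: B_def)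
        then have "B \<noteq> {}" using Y by auto
        moreover have "B \<inter> \<Union>F = {}" using F by (auto simp: B_def)
        ultimately have "B \<notin> F" by auto
        have "sensitive_blocks f Y (insert B F)"
          using F fB Y \<open>B \<inter> \<Union>F = {}\<close>
          by (auto simp: sensitive_blocks_def pairwise_insert disjnt_def)
        moreover have "\<Union>(insert B F) \<subseteq> - Q"
          using F YQ Z(1) by (auto simp: B_def)
        ultimately have "card (insert B F) \<le> Suc m"
          using Suc.prems[of Y] YQ Y(2) by blast
        then show "card F \<le> m" using \<open>B \<notin> F\<close> by simp
      qed
    qed simp
    then obtain t where t: "depth t \<le> card C + m * K"
      "\<forall>Y. (\<forall>i\<in>Q. Y $ i = X0 $ i) \<longrightarrow> run t Y = f Y" by blast
    from t(1) C(1) have "depth t \<le> Suc m * K" by simp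
    with t(2) show ?thesis by blast
  qed
qed

lemma tree_of_block_sensitivity:
  fixes f :: "bool ^ 'n::finite \<Rightarrow> bool"
  assumes bs: "\<And>X F. sensitive_blocks f X F \<Longrightarrow> card F \<le> k"
  obtains t where "computes t f" "depth t \<le> k ^ 3"
proof -
  have "\<exists>C. card C \<le> k ^ 2 \<and> (\<forall>Y. (\<forall>i\<in>C. Y $ i = X $ i) \<longrightarrow> f Y = f X)" for X
    using certificate_exists[of f k X] bs by metis
  \<comment> \<open>With \<open>Q = {}\<close> every input is consistent with any \<open>X0\<close>,
    even \<open>undefined\<close>.\<close>
  from certificate_tree[OF this, of "{}" undefined k] bs
  obtain t where "depth t \<le> k * k ^ 2" "\<forall>Y. run t Y = f Y" by auto
  then show ?thesis
    by (intro that[of t]) (auto simp: computes_def power2_eq_square power3_eq_cube)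
qed

section \<open>Polynomials from decision trees\<close>

text \<open>A query of variable \<open>i\<close> yields p0 + x_i (p1 - p0), made multilinear by
  x_i^2 = x_i on the cube, so the degree grows by at most one per query.\<close>

lemma mlpoly_of_tree:
  fixes t :: "'n::finite dtree"
  shows "\<exists>c. (\<forall>S. c S \<noteq> 0 \<longrightarrow> card S \<le> depth t) \<and>
           (\<forall>X. mlpoly_eval c (real_point X) = of_bool (run t X))"
proof (induction t)
  case (Leaf b)
  have "mlpoly_eval (\<lambda>S. if S = {} then of_bool b else 0) x = of_bool b" for x :: "real ^ 'n"
    unfolding mlpoly_eval_def by (subst sum.mono_neutral_right[of UNIV "{{}}"]) auto
  then show ?case
    by (intro exI[of _ "\<lambda>S. if S = {} then of_bool b else 0"]) auto
next
  case (Query i t0 t1)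
  then obtain c0 c1 where
    c0: "\<And>S. c0 S \<noteq> 0 \<Longrightarrow> card S \<le> depth t0" "\<And>X. mlpoly_eval c0 (real_point X) = of_bool (run t0 X)"
    and c1: "\<And>S. c1 S \<noteq> 0 \<Longrightarrow> card S \<le> depth t1" "\<And>X. mlpoly_eval c1 (real_point X) = of_bool (run t1 X)"
    by blast
  \<comment> \<open>After the reduction, multiplying by x_i sends monomial \<open>T\<close> to
    \<open>insert i T\<close>, so the coefficients at \<open>S\<close> and \<open>S - {i}\<close>
    merge when \<open>i\<close> lies in \<open>S\<close>.\<close>
  define m where "m S = (\<Sum>T\<in>{T\<in>UNIV. insert i T = S}. c1 T - c0 T)" for S
  have "card S \<le> Suc (max (depth t0) (depth t1))" if "c0 S + m S \<noteq> 0" for S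
  proof (cases "c0 S = 0")
    case True
    with that have "m S \<noteq> 0" by simp
    then obtain T where T: "insert i T = S" "c1 T - c0 T \<noteq> 0"
      unfolding m_def by (auto elim: sum.not_neutral_contains_not_neutral)
    then have "card T \<le> max (depth t0) (depth t1)"
      using c0(1)[of T] c1(1)[of T] by fastforce
    then show ?thesis
      using T card_insert_le_m1[of "Suc (card T)" T i] by (auto simp: card_insert_if)
  qed (use c0(1)[of S] in auto)
  moreover have "mlpoly_eval (\<lambda>S. c0 S + m S) (real_point X) = of_bool (run (Query i t0 t1) X)" for X
  proof -
    let ?x = "\<lambda>j. real_point X $ j"
    have "mlpoly_eval m (real_point X)
        = (\<Sum>S\<in>UNIV. \<Sum>T\<in>{T\<in>UNIV. insert i T = S}. (c1 T - c0 T) * prod ?x (insert i T))"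
      unfolding mlpoly_eval_def m_def by (auto simp: sum_distrib_right intro!: sum.cong)
    also have "\<dots> = (\<Sum>T\<in>UNIV. (c1 T - c0 T) * prod ?x (insert i T))"
      by (rule sum.group) auto
    also have "\<dots> = (\<Sum>T\<in>UNIV. ?x i * ((c1 T - c0 T) * prod ?x T))"
    proof (intro sum.cong refl)
      fix T
      have "prod ?x (insert i T) = ?x i * prod ?x T"
        by (cases "i \<in> T") (auto simp: insert_absorb real_point_def)
      then show "(c1 T - c0 T) * prod ?x (insert i T) = ?x i * ((c1 T - c0 T) * prod ?x T)"
        by simp
    qed
    also have "\<dots> = ?x i * (mlpoly_eval c1 (real_point X) - mlpoly_eval c0 (real_point X))"
      by (simp add: mlpoly_eval_def left_diff_distrib sum_subtractf flip: sum_distrib_left)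
    finally have "mlpoly_eval (\<lambda>S. c0 S + m S) (real_point X) = mlpoly_eval c0 (real_point X) +
        ?x i * (mlpoly_eval c1 (real_point X) - mlpoly_eval c0 (real_point X))"
      by (simp add: mlpoly_eval_def distrib_right sum.distrib)
    moreover have "?x i = of_bool (X $ i)"
      by (simp add: real_point_def)
    ultimately show ?thesis
      by (simp add: c0(2) c1(2))
  qed
  ultimately show ?case
    by (intro exI[of _ "\<lambda>S. c0 S + m S"]) auto
qed

lemma approximating_mlpoly_of_tree:
  fixes t :: "'n::finite dtree"
  assumes "computes t f"
  obtains c where "approximates c f" "mlpoly_degree c \<le> depth t"
proof -
  obtain c where c: "\<And>S. c S \<noteq> 0 \<Longrightarrow> card S \<le> depth t"
    "\<And>X. mlpoly_eval c (real_point X) = of_bool (run t X)"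
    using mlpoly_of_tree[of t] by blast
  show ?thesis
  proof
    show "approximates c f"
      using assms c by (simp add: approximates_def computes_def)
    show "mlpoly_degree c \<le> depth t"
      unfolding mlpoly_degree_def using c(1) by (subst Max_le_iff) auto
  qed
qed

theorem corollary5p5:
  fixes f :: "bool ^ 'n::finite \<Rightarrow> bool"
  shows "approx_degree f \<le> det_complexity f \<and> det_complexity f \<le> 216 * approx_degree f ^ 6"
proof -
  \<comment> \<open>A crude bound suffices to obtain some tree computing \<open>f\<close>, so that
    the minimum in \<open>det_complexity\<close> is attained.\<close>
  have "card F \<le> card (UNIV :: 'n set set)" if "sensitive_blocks f X F" for X F
    by (intro card_mono) auto
  then obtain t0 where "computes t0 f"
    by (rule tree_of_block_sensitivity)
  then have "\<exists>t. computes t f \<and> depth t = det_complexity f"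
    unfolding det_complexity_def
    using LeastI_ex[of "\<lambda>d. \<exists>t. computes t f \<and> depth t = d"] by blast
  then obtain t where t: "computes t f" "depth t = det_complexity f" by blast
  obtain c where c: "approximates c f" "mlpoly_degree c \<le> depth t"
    using t(1) by (rule approximating_mlpoly_of_tree)
  have "approx_degree f \<le> mlpoly_degree c"
    unfolding approx_degree_def using c(1) by (intro Least_le) blast
  then have lower: "approx_degree f \<le> det_complexity f"
    using c(2) t(2) by simp
  have "\<exists>c. approximates c f \<and> mlpoly_degree c = approx_degree f"
    unfolding approx_degree_def
    using LeastI_ex[of "\<lambda>d. \<exists>c. approximates c f \<and> mlpoly_degree c = d"] c(1) by blast
  then obtain c' where c': "approximates c' f" "mlpoly_degree c' = approx_degree f" by blast
  obtain t' where t': "computes t' f" "depth t' \<le> (5 * mlpoly_degree c' ^ 2) ^ 3"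
    using card_sensitive_blocks_le[OF c'(1)] by (rule tree_of_block_sensitivity)
  have "det_complexity f \<le> depth t'"
    unfolding det_complexity_def using t'(1) by (intro Least_le) blast
  \<comment> \<open>This is \<open>(5 * d^2)^3 = 125 * d^6\<close>.\<close>
  also have "\<dots> \<le> 125 * approx_degree f ^ 6"
    using t'(2) by (simp add: c'(2) power_mult_distrib flip: power_mult)
  also have "\<dots> \<le> 216 * approx_degree f ^ 6" by simp
  finally show ?thesis using lower by simp
qed

end
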